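(* Let $\mathbf{A}\in\mathbb{R}^{M\times N}$, let $p_0(\mathbf{x})=\prod_{i=1}^N p_0(x_i)$ be a factorized prior on $\mathbb{R}^N$, let $p(\mathbf{y}|\mathbf{z})=\prod_{a=1}^M p(y_a|z_a)$ be a factorized output channel, and let $\mathbf{y}\in\mathbb{R}^M$ be the observation. Run the algorithms Gr-AMP with $\mathrm{Iter}_{SLM}=1$ inner iteration per outer iteration and GAMP (both defined in the context) from the same initial values $\hat{x}_i(0)$, $V_a(0)$, $Z_a(0)$ $(1\le i\le N,\ 1\le a\le M)$, and assume that all quantities appearing are well defined at every iteration. Then Gr-AMP with $\mathrm{Iter}_{SLM}=1$ is equivalent to GAMP: for every $t\ge 1$, the values $\Sigma_i(t-1)$, $r_i(t-1)$, $\hat{x}_i(t)$, $\tau_i(t)$ $(1\le i\le N)$ and $V_a(t)$, $Z_a(t)$ $(1\le a\le M)$ produced by the two algorithms coincide.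
   Context: Model: $\mathbf{x}\in\mathbb{R}^N$ has prior $p_0$, $\mathbf{z}=\mathbf{A}\mathbf{x}$ with $\mathbf{A}=(A_{ai})$ known, and $\mathbf{y}$ is observed through $p(\mathbf{y}|\mathbf{z})=\prod_a p(y_a|z_a)$. $\mathcal{N}(u;m,v)$ denotes the Gaussian density in $u$ with mean $m$ and variance $v$. Scalar estimators. For $m\in\mathbb{R}$, $v>0$, let $\mathsf{E}(z_a|m,v)$ and $\mathsf{Var}(z_a|m,v)$ be the mean and variance of the probability distribution on $\mathbb{R}$ proportional to $p(y_a|z_a)\,\mathcal{N}(z_a;m,v)$. For $r\in\mathbb{R}$, $\Sigma>0$, let $\mathsf{E}(x_i|r,\Sigma)$ and $\mathsf{Var}(x_i|r,\Sigma)$ be the mean and variance of the probability distribution proportional to $p_0(x_i)\,\mathcal{N}(x_i;r,\Sigma)$. Gr-AMP with $\mathrm{Iter}_{SLM}=1$. State at time $t-1$: $(\hat{x}_i(t-1))_i$, $(V_a(t-1))_a$, $(Z_a(t-1))_a$, with $z_{a,A}^{\mathrm{ext}}(t-1)=Z_a(t-1)$ and $v_{a,A}^{\mathrm{ext}}(t-1)=V_a(t-1)$. The $t$-th iteration is as follows. (1) Set $z_{a,B}^{\mathrm{post}}(t)=\mathsf{E}(z_a|Z_a(t-1),V_a(t-1))$ and $v_{a,B}^{\mathrm{post}}(t)=\mathsf{Var}(z_a|Z_a(t-1),V_a(t-1))$. (2) Compute the pseudo-noise variance and pseudo-observation $$\tilde\sigma_a^2(t)=\Bigl(\frac{1}{v_{a,B}^{\mathrm{post}}(t)}-\frac{1}{V_a(t-1)}\Bigr)^{-1},\qquad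 \tilde y_a(t)=\tilde\sigma_a^2(t)\Bigl(\frac{z_{a,B}^{\mathrm{post}}(t)}{v_{a,B}^{\mathrm{post}}(t)}-\frac{Z_a(t-1)}{V_a(t-1)}\Bigr).$$ (3) Perform one iteration of AMP, continuing from the current state, for the linear model $\tilde{\mathbf{y}}(t)=\mathbf{A}\mathbf{x}+\tilde{\mathbf{w}}(t)$ with independent Gaussian noise of variances $\tilde\sigma_a^2(t)$: $$\Sigma_i(t-1)=\Bigl[\sum_a\frac{A_{ai}^2}{\tilde\sigma_a^2(t)+V_a(t-1)}\Bigr]^{-1},\qquad r_i(t-1)=\hat{x}_i(t-1)+\Sigma_i(t-1)\sum_a\frac{A_{ai}(\tilde y_a(t)-Z_a(t-1))}{\tilde\sigma_a^2(t)+V_a(t-1)},$$ $$\hat{x}_i(t)=\mathsf{E}(x_i|r_i(t-1),\Sigma_i(t-1)),\qquad \tau_i(t)=\mathsf{Var}(x_i|r_i(t-1),\Sigma_i(t-1)),$$ $$V_a(t)=\sum_i A_{ai}^2\tau_i(t),\qquad Z_a(t)=\sum_i A_{ai}\hat{x}_i(t)-\frac{V_a(t)\,(\tilde y_a(t)-Z_a(t-1))}{\tilde\sigma_a^2(t)+V_a(t-1)}.$$ GAMP. With the same kind of state at time $t-1$, the $t$-th iteration is $$\hat{s}_a(t-1)=\frac{\mathsf{E}(z_a|Z_a(t-1),V_a(t-1))-Z_a(t-1)}{V_a(t-1)},\qquad \tau_a^s(t-1)=\frac{V_a(t-1)-\mathsf{Var}(z_a|Z_a(t-1),V_a(t-1))}{V_a^2(t-1)},$$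 $$\Sigma_i(t-1)=\Bigl[\sum_a A_{ai}^2\tau_a^s(t-1)\Bigr]^{-1},\qquad r_i(t-1)=\hat{x}_i(t-1)+\Sigma_i(t-1)\sum_a A_{ai}\hat{s}_a(t-1),$$ $$\hat{x}_i(t)=\mathsf{E}(x_i|r_i(t-1),\Sigma_i(t-1)),\qquad \tau_i(t)=\mathsf{Var}(x_i|r_i(t-1),\Sigma_i(t-1)),$$ $$V_a(t)=\sum_i A_{ai}^2\tau_i(t),\qquad Z_a(t)=\sum_i A_{ai}\hat{x}_i(t)-V_a(t)\hat{s}_a(t-1).$$ "All quantities are well defined at every iteration" means, for all $t\ge1$ and all $i,a$: the scalar posterior distributions used exist and have finite variance; $V_a(t-1)>0$; $v_{a,B}^{\mathrm{post}}(t)>0$; $v_{a,B}^{\mathrm{post}}(t)\neq V_a(t-1)$; and the sums inverted in the definitions of $\Sigma_i(t-1)$ are positive. *)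

theory Defs
  imports "HOL-Probability.Probability"
begin

(* A Gaussian is specified by its variance here, whereas normal_density expects
   the standard deviation. *)
definition gauss :: "real \<Rightarrow> real \<Rightarrow> real \<Rightarrow> real" where
  "gauss u m v = normal_density m (sqrt v) u"

section \<open>Priors and output channels\<close>

text \<open>The prior is a Borel probability measure rather than a density, so that priors with
  atoms (such as Bernoulli-Gaussian ones) are included.\<close>

definition scalar_prior :: "real measure \<Rightarrow> bool" where
  "scalar_prior p0 \<longleftrightarrow> prob_space p0 \<and> sets p0 = sets borel"

definition factorized_prior :: "(real ^ 'n::finite) measure \<Rightarrow> real measure \<Rightarrow> bool" where
  "factorized_prior P0 p0 \<longleftrightarrow> scalar_prior p0 \<and>
     P0 = distr (\<Pi>\<^sub>M i\<in>(UNIV :: 'n set). p0) borel (\<lambda>x. \<chi> i. x i)"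

text \<open>\<open>p y z\<close> is the value of $p(y|z)$, a conditional density of the output with respect to a
  reference measure \<open>\<nu>\<close>: Lebesgue measure for continuous outputs, a counting measure on the
  output alphabet for discrete ones.\<close>

definition scalar_channel :: "real measure \<Rightarrow> (real \<Rightarrow> real \<Rightarrow> real) \<Rightarrow> bool" where
  "scalar_channel \<nu> p \<longleftrightarrow>
     sigma_finite_measure \<nu> \<and> sets \<nu> = sets borel \<and>
     (\<lambda>(y, z). p y z) \<in> borel_measurable (borel \<Otimes>\<^sub>M borel) \<and>
     (\<forall>y z. 0 \<le> p y z) \<and>
     (\<forall>z. (\<integral>\<^sup>+ y. ennreal (p y z) \<partial>\<nu>) = 1)"

definition factorized_channel ::
  "(real ^ 'm::finite \<Rightarrow> real ^ 'm \<Rightarrow> real) \<Rightarrow> real measure \<Rightarrow> (real \<Rightarrow> real \<Rightarrow> real) \<Rightarrow> bool" where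
  "factorized_channel P \<nu> p \<longleftrightarrow> scalar_channel \<nu> p \<and>
     (\<forall>y z. P y z = (\<Prod>a\<in>UNIV. p (y $ a) (z $ a)))"

section \<open>Scalar estimators\<close>

definition normalizer :: "real measure \<Rightarrow> (real \<Rightarrow> real) \<Rightarrow> ennreal" where
  "normalizer M f = (\<integral>\<^sup>+ u. ennreal (f u) \<partial>M)"

text \<open>The distribution proportional to \<open>f\<close> with respect to \<open>M\<close>; it is meaningful only if the
  normalizer is positive and finite, which is part of \<open>well_posed\<close> below.\<close>

definition normalized :: "real measure \<Rightarrow> (real \<Rightarrow> real) \<Rightarrow> real measure" where
  "normalized M f = density M (\<lambda>u. ennreal (f u) / normalizer M f)"

definition mean :: "real measure \<Rightarrow> real" where
  "mean D = (\<integral>u. u \<partial>D)"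

definition var :: "real measure \<Rightarrow> real" where
  "var D = (\<integral>u. (u - mean D)\<^sup>2 \<partial>D)"

definition well_posed :: "real measure \<Rightarrow> (real \<Rightarrow> real) \<Rightarrow> bool" where
  "well_posed M f \<longleftrightarrow> 0 < normalizer M f \<and> normalizer M f < \<infinity> \<and>
     integrable (normalized M f) (\<lambda>u. u\<^sup>2)"

definition z_weight :: "(real \<Rightarrow> real \<Rightarrow> real) \<Rightarrow> real \<Rightarrow> real \<Rightarrow> real \<Rightarrow> real \<Rightarrow> real" where
  "z_weight p y m v = (\<lambda>z. p y z * gauss z m v)"

definition x_weight :: "real \<Rightarrow> real \<Rightarrow> real \<Rightarrow> real" where
  "x_weight r \<Sigma> = (\<lambda>x. gauss x r \<Sigma>)"

definition E_z :: "(real \<Rightarrow> real \<Rightarrow> real) \<Rightarrow> real \<Rightarrow> real \<Rightarrow> real \<Rightarrow> real" where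
  "E_z p y m v = mean (normalized lborel (z_weight p y m v))"

definition Var_z :: "(real \<Rightarrow> real \<Rightarrow> real) \<Rightarrow> real \<Rightarrow> real \<Rightarrow> real \<Rightarrow> real" where
  "Var_z p y m v = var (normalized lborel (z_weight p y m v))"

definition E_x :: "real measure \<Rightarrow> real \<Rightarrow> real \<Rightarrow> real" where
  "E_x p0 r \<Sigma> = mean (normalized p0 (x_weight r \<Sigma>))"

definition Var_x :: "real measure \<Rightarrow> real \<Rightarrow> real \<Rightarrow> real" where
  "Var_x p0 r \<Sigma> = var (normalized p0 (x_weight r \<Sigma>))"

section \<open>States and iterations\<close>

text \<open>The record \<open>iterate\<close> collects what iteration \<open>t\<close> produces: $\hat x(t)$, $V(t)$, $Z(t)$,
  $\tau(t)$ together with $\Sigma(t-1)$ and $r(t-1)$. Its first three fields form the state from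
  which iteration \<open>t + 1\<close> starts.\<close>

record ('n::finite, 'm::finite) state =
  x_of :: "real ^ 'n"
  V_of :: "real ^ 'm"
  Z_of :: "real ^ 'm"

record ('n::finite, 'm::finite) iterate = "('n, 'm) state" +
  Sigma_of :: "real ^ 'n"
  r_of :: "real ^ 'n"
  tau_of :: "real ^ 'n"

primrec state_at ::
  "(('n::finite, 'm::finite) state \<Rightarrow> ('n, 'm) iterate) \<Rightarrow> ('n, 'm) state \<Rightarrow> nat \<Rightarrow> ('n, 'm) state" where
  "state_at step s0 0 = s0"
| "state_at step s0 (Suc t) = state.truncate (step (state_at step s0 t))"

text \<open>The outcome of iteration \<open>t\<close>, for \<open>t \<ge> 1\<close>.\<close>

definition iterate_at ::
  "(('n::finite, 'm::finite) state \<Rightarrow> ('n, 'm) iterate) \<Rightarrow> ('n, 'm) state \<Rightarrow> nat \<Rightarrow> ('n, 'm) iterate" where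
  "iterate_at step s0 t = step (state_at step s0 (t - 1))"

section \<open>AMP for a linear model with noise of component-wise variances\<close>

definition amp_precision ::
  "real ^ 'n::finite ^ 'm::finite \<Rightarrow> real ^ 'm \<Rightarrow> ('n, 'm) state \<Rightarrow> 'n \<Rightarrow> real" where
  "amp_precision A \<sigma>2 s i = (\<Sum>a\<in>UNIV. (A $ a $ i)\<^sup>2 / (\<sigma>2 $ a + V_of s $ a))"

definition amp_step ::
  "real ^ 'n::finite ^ 'm::finite \<Rightarrow> real measure \<Rightarrow> real ^ 'm \<Rightarrow> real ^ 'm
     \<Rightarrow> ('n, 'm) state \<Rightarrow> ('n, 'm) iterate" where
  "amp_step A p0 yt \<sigma>2 s =
     (let \<Sigma> = (\<chi> i. inverse (amp_precision A \<sigma>2 s i));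
          r' = (\<chi> i. x_of s $ i + \<Sigma> $ i *
                  (\<Sum>a\<in>UNIV. A $ a $ i * (yt $ a - Z_of s $ a) / (\<sigma>2 $ a + V_of s $ a)));
          x' = (\<chi> i. E_x p0 (r' $ i) (\<Sigma> $ i));
          \<tau>' = (\<chi> i. Var_x p0 (r' $ i) (\<Sigma> $ i));
          V' = (\<chi> a. \<Sum>i\<in>UNIV. (A $ a $ i)\<^sup>2 * \<tau>' $ i);
          Z' = (\<chi> a. (\<Sum>i\<in>UNIV. A $ a $ i * x' $ i)
                  - V' $ a * (yt $ a - Z_of s $ a) / (\<sigma>2 $ a + V_of s $ a))
      in \<lparr>x_of = x', V_of = V', Z_of = Z', Sigma_of = \<Sigma>, r_of = r', tau_of = \<tau>'\<rparr>)"

section \<open>Gr-AMP with one inner iteration\<close>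

definition z_post :: "(real \<Rightarrow> real \<Rightarrow> real) \<Rightarrow> real ^ 'm::finite \<Rightarrow> ('n::finite, 'm) state \<Rightarrow> real ^ 'm" where
  "z_post p y s = (\<chi> a. E_z p (y $ a) (Z_of s $ a) (V_of s $ a))"

definition v_post :: "(real \<Rightarrow> real \<Rightarrow> real) \<Rightarrow> real ^ 'm::finite \<Rightarrow> ('n::finite, 'm) state \<Rightarrow> real ^ 'm" where
  "v_post p y s = (\<chi> a. Var_z p (y $ a) (Z_of s $ a) (V_of s $ a))"

definition pseudo_var :: "(real \<Rightarrow> real \<Rightarrow> real) \<Rightarrow> real ^ 'm::finite \<Rightarrow> ('n::finite, 'm) state \<Rightarrow> real ^ 'm" where
  "pseudo_var p y s = (\<chi> a. inverse (1 / v_post p y s $ a - 1 / V_of s $ a))"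

definition pseudo_obs :: "(real \<Rightarrow> real \<Rightarrow> real) \<Rightarrow> real ^ 'm::finite \<Rightarrow> ('n::finite, 'm) state \<Rightarrow> real ^ 'm" where
  "pseudo_obs p y s = (\<chi> a. pseudo_var p y s $ a *
     (z_post p y s $ a / v_post p y s $ a - Z_of s $ a / V_of s $ a))"

definition gramp_step ::
  "real ^ 'n::finite ^ 'm::finite \<Rightarrow> real measure \<Rightarrow> (real \<Rightarrow> real \<Rightarrow> real) \<Rightarrow> real ^ 'm
     \<Rightarrow> ('n, 'm) state \<Rightarrow> ('n, 'm) iterate" where
  "gramp_step A p0 p y s = amp_step A p0 (pseudo_obs p y s) (pseudo_var p y s) s"

section \<open>GAMP\<close>

definition s_hat :: "(real \<Rightarrow> real \<Rightarrow> real) \<Rightarrow> real ^ 'm::finite \<Rightarrow> ('n::finite, 'm) state \<Rightarrow> real ^ 'm" where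
  "s_hat p y s = (\<chi> a. (E_z p (y $ a) (Z_of s $ a) (V_of s $ a) - Z_of s $ a) / V_of s $ a)"

definition tau_s :: "(real \<Rightarrow> real \<Rightarrow> real) \<Rightarrow> real ^ 'm::finite \<Rightarrow> ('n::finite, 'm) state \<Rightarrow> real ^ 'm" where
  "tau_s p y s = (\<chi> a. (V_of s $ a - Var_z p (y $ a) (Z_of s $ a) (V_of s $ a)) / (V_of s $ a)\<^sup>2)"

definition gamp_precision ::
  "real ^ 'n::finite ^ 'm::finite \<Rightarrow> (real \<Rightarrow> real \<Rightarrow> real) \<Rightarrow> real ^ 'm \<Rightarrow> ('n, 'm) state \<Rightarrow> 'n \<Rightarrow> real" where
  "gamp_precision A p y s i = (\<Sum>a\<in>UNIV. (A $ a $ i)\<^sup>2 * tau_s p y s $ a)"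

definition gamp_step ::
  "real ^ 'n::finite ^ 'm::finite \<Rightarrow> real measure \<Rightarrow> (real \<Rightarrow> real \<Rightarrow> real) \<Rightarrow> real ^ 'm
     \<Rightarrow> ('n, 'm) state \<Rightarrow> ('n, 'm) iterate" where
  "gamp_step A p0 p y s =
     (let \<Sigma> = (\<chi> i. inverse (gamp_precision A p y s i));
          r' = (\<chi> i. x_of s $ i + \<Sigma> $ i * (\<Sum>a\<in>UNIV. A $ a $ i * s_hat p y s $ a));
          x' = (\<chi> i. E_x p0 (r' $ i) (\<Sigma> $ i));
          \<tau>' = (\<chi> i. Var_x p0 (r' $ i) (\<Sigma> $ i));
          V' = (\<chi> a. \<Sum>i\<in>UNIV. (A $ a $ i)\<^sup>2 * \<tau>' $ i);
          Z' = (\<chi> a. (\<Sum>i\<in>UNIV. A $ a $ i * x' $ i) - V' $ a * s_hat p y s $ a)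
      in \<lparr>x_of = x', V_of = V', Z_of = Z', Sigma_of = \<Sigma>, r_of = r', tau_of = \<tau>'\<rparr>)"

section \<open>Well-definedness of the runs\<close>

definition gramp_well_defined ::
  "real ^ 'n::finite ^ 'm::finite \<Rightarrow> real measure \<Rightarrow> (real \<Rightarrow> real \<Rightarrow> real) \<Rightarrow> real ^ 'm
     \<Rightarrow> ('n, 'm) state \<Rightarrow> bool" where
  "gramp_well_defined A p0 p y s0 \<longleftrightarrow>
     (\<forall>t\<ge>1. let s = state_at (gramp_step A p0 p y) s0 (t - 1);
                 g = iterate_at (gramp_step A p0 p y) s0 t
       in (\<forall>a. 0 < V_of s $ a \<and> well_posed lborel (z_weight p (y $ a) (Z_of s $ a) (V_of s $ a)) \<and>
               0 < v_post p y s $ a \<and> v_post p y s $ a \<noteq> V_of s $ a) \<and>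
          (\<forall>i. 0 < amp_precision A (pseudo_var p y s) s i \<and>
               well_posed p0 (x_weight (r_of g $ i) (Sigma_of g $ i))))"

text \<open>For GAMP, \<open>v_post p y s $ a\<close> is the posterior variance entering \<open>tau_s p y s $ a\<close>; the
  conditions on it that are needed only to form the pseudo-noise variance are not imposed.\<close>

definition gamp_well_defined ::
  "real ^ 'n::finite ^ 'm::finite \<Rightarrow> real measure \<Rightarrow> (real \<Rightarrow> real \<Rightarrow> real) \<Rightarrow> real ^ 'm
     \<Rightarrow> ('n, 'm) state \<Rightarrow> bool" where
  "gamp_well_defined A p0 p y s0 \<longleftrightarrow>
     (\<forall>t\<ge>1. let s = state_at (gamp_step A p0 p y) s0 (t - 1);
                 g = iterate_at (gamp_step A p0 p y) s0 t
       in (\<forall>a. 0 < V_of s $ a \<and> well_posed lborel (z_weight p (y $ a) (Z_of s $ a) (V_of s $ a))) \<and>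
          (\<forall>i. 0 < gamp_precision A p y s i \<and>
               well_posed p0 (x_weight (r_of g $ i) (Sigma_of g $ i))))"

end

(* The pseudo-noise variance \<sigma>2 and pseudo-observation yt satisfy
   \<sigma>2 + V = V^2 / (V - v) and yt - Z = V * (z - Z) / (V - v). Hence the coefficients
   1 / (\<sigma>2 + V) and (yt - Z) / (\<sigma>2 + V), through which alone AMP sees the pseudo-model, are
   GAMP's \<tau>s and s-hat. *)
theory Submission
  imports Defs
begin

text \<open>The inverse is \<open>v * V / (V - v)\<close>; over this denominator the added
  \<open>V\<close> contributes \<open>V * V - v * V\<close>, which cancels
  \<open>v * V\<close>.\<close>

lemma pseudo_var_plus_variance:
  fixes v V :: real
  assumes "v \<noteq> 0" "V \<noteq> 0" "v \<noteq> V"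
  shows "inverse (1 / v - 1 / V) + V = V\<^sup>2 / (V - v)"
  using assms by (simp add: field_simps power2_eq_square)

text \<open>The pseudo-observation equals \<open>(z * V - Z * v) / (V - v)\<close>, and subtracting
  \<open>Z\<close> cancels the term \<open>Z * v\<close>.\<close>

lemma pseudo_obs_minus_mean:
  fixes v V z Z :: real
  assumes "v \<noteq> 0" "V \<noteq> 0" "v \<noteq> V"
  shows "inverse (1 / v - 1 / V) * (z / v - Z / V) - Z = V * (z - Z) / (V - v)"
proof -
  have "1 / v - 1 / V = (V - v) / (v * V)" "z / v - Z / V = (z * V - Z * v) / (v * V)"
    using assms by (simp_all add: diff_frac_eq)
  then show ?thesis
    using assms by (simp add: field_simps)
qed

lemma gramp_step_eq_gamp_step:
  assumes V: "\<And>a. V_of s $ a \<noteq> 0"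
    and v: "\<And>a. v_post p y s $ a \<noteq> 0"
    and neq: "\<And>a. v_post p y s $ a \<noteq> V_of s $ a"
  shows "gramp_step A p0 p y s = gamp_step A p0 p y s"
proof -
  let ?d = "\<lambda>a. pseudo_var p y s $ a + V_of s $ a"
  have d: "?d a = (V_of s $ a)\<^sup>2 / (V_of s $ a - v_post p y s $ a)" for a
    unfolding pseudo_var_def using pseudo_var_plus_variance[OF v V neq] by simp
  have n: "pseudo_obs p y s $ a - Z_of s $ a =
      V_of s $ a * (z_post p y s $ a - Z_of s $ a) / (V_of s $ a - v_post p y s $ a)" for a
    unfolding pseudo_obs_def pseudo_var_def using pseudo_obs_minus_mean[OF v V neq] by simp
  \<comment> \<open>The factor \<open>c\<close> is left free: it becomes the squared matrix entry
    here, and in \<open>shat\<close> both the matrix entry (for \<open>r'\<close>) and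
    \<open>V' $ a\<close> (for the correction in \<open>Z'\<close>).\<close>
  have tau: "c / ?d a = c * tau_s p y s $ a" for c a
    unfolding d by (simp add: tau_s_def v_post_def)
  have shat: "c * (pseudo_obs p y s $ a - Z_of s $ a) / ?d a = c * s_hat p y s $ a" for c a
    unfolding d n using V[of a] neq[of a]
    by (simp add: s_hat_def z_post_def power2_eq_square)
  show ?thesis
    \<comment> \<open>\<open>shat\<close> must act before \<open>tau\<close>, whose left-hand side
      also matches the quotients meant for \<open>shat\<close>.\<close>
    unfolding gramp_step_def amp_step_def gamp_step_def amp_precision_def gamp_precision_def shat
    by (simp add: tau)
qed

theorem mainTheorem1:
  fixes A :: "real ^ 'n::finite ^ 'm::finite"
    and P0 :: "(real ^ 'n) measure" and p0 :: "real measure"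
    and P :: "real ^ 'm \<Rightarrow> real ^ 'm \<Rightarrow> real" and p :: "real \<Rightarrow> real \<Rightarrow> real"
    and \<nu> :: "real measure"
    and y :: "real ^ 'm"
    and s0 :: "('n, 'm) state"
  assumes prior: "factorized_prior P0 p0"
    and channel: "factorized_channel P \<nu> p"
    and gramp_wd: "gramp_well_defined A p0 p y s0"
    and gamp_wd: "gamp_well_defined A p0 p y s0"
  shows "\<forall>t\<ge>1.
    let g = iterate_at (gramp_step A p0 p y) s0 t;
        h = iterate_at (gamp_step A p0 p y) s0 t
    in (\<forall>i. Sigma_of g $ i = Sigma_of h $ i \<and> r_of g $ i = r_of h $ i \<and>
            x_of g $ i = x_of h $ i \<and> tau_of g $ i = tau_of h $ i) \<and>
       (\<forall>a. V_of g $ a = V_of h $ a \<and> Z_of g $ a = Z_of h $ a)"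
proof -
  have step: "gramp_step A p0 p y (state_at (gramp_step A p0 p y) s0 t) =
      gamp_step A p0 p y (state_at (gramp_step A p0 p y) s0 t)" for t
  proof (rule gramp_step_eq_gamp_step)
    fix a
    let ?s = "state_at (gramp_step A p0 p y) s0 t"
    have "0 < V_of ?s $ a \<and> 0 < v_post p y ?s $ a \<and> v_post p y ?s $ a \<noteq> V_of ?s $ a"
      \<comment> \<open>Iteration \<open>Suc t\<close> is the one that starts from state
        \<open>t\<close>.\<close>
      using gramp_wd[unfolded gramp_well_defined_def, rule_format, of "Suc t"]
      by (simp add: Let_def)
    then show "V_of ?s $ a \<noteq> 0" "v_post p y ?s $ a \<noteq> 0" "v_post p y ?s $ a \<noteq> V_of ?s $ a"
      by auto
  qed
  have state: "state_at (gramp_step A p0 p y) s0 t = state_at (gamp_step A p0 p y) s0 t" for t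
    by (induction t) (simp, metis state_at.simps(2) step)
  \<comment> \<open>States are truncated, so \<open>Sigma_of\<close>, \<open>r_of\<close> and
    \<open>tau_of\<close> are compared by applying one more full step to equal states.\<close>
  have "iterate_at (gramp_step A p0 p y) s0 t = iterate_at (gamp_step A p0 p y) s0 t" for t
    unfolding iterate_at_def by (metis step state)
  then show ?thesis
    by simp
qed

end
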